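(* Let $X$ be a Banach space. For a bounded subset $A$ of $X$ the following are equivalent: (1) $A$ is relatively weakly compact. (2) Every sequence in $A$ admits a convex block subsequence that is norm convergent. (3) Every sequence in $A$ admits a convex block subsequence that is weakly convergent.
   Context: Banach spaces are infinite-dimensional, over the real or complex field. A sequence $(y_n)_{n=1}^\infty$ is a convex block subsequence of $(x_n)_{n=1}^\infty$ if there is a strictly increasing sequence of positive integers $(k_n)_{n=1}^\infty$ such that, with $k_0=0$, $y_n\in\operatorname{conv}\{x_i: k_{n-1}+1\leqslant i\leqslant k_n\}$ for every $n\in\mathbb N$. Convergence means convergence to an element of $X$. *)

theory Defs
  imports "HOL-Analysis.Analysis"
begin

text \<open>
  The scalar fields are exactly \<open>\<real>\<close> and \<open>\<complex>\<close>, up to isometric isomorphism of real normed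
  fields; both are instances.
\<close>

class real_or_complex_field = real_normed_field +
  assumes real_or_complex:
    "(\<forall>z. \<exists>a. z = a *\<^sub>R 1) \<or>
     (\<exists>i. i * i = - 1 \<and> (\<forall>a b. norm (a *\<^sub>R 1 + b *\<^sub>R i) = sqrt (a\<^sup>2 + b\<^sup>2)) \<and>
          (\<forall>z. \<exists>a b. z = a *\<^sub>R 1 + b *\<^sub>R i))"

instance real :: real_or_complex_field
  by standard auto

instance complex :: real_or_complex_field
proof
  have 1: "norm (a *\<^sub>R 1 + b *\<^sub>R \<i>) = sqrt (a\<^sup>2 + b\<^sup>2)" for a b
    by (simp add: norm_complex_def)
  have 2: "\<exists>a b. z = a *\<^sub>R 1 + b *\<^sub>R \<i>" for z
    by (rule exI[of _ "Re z"], rule exI[of _ "Im z"]) (simp add: complex_eq_iff)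
  show "(\<forall>z :: complex. \<exists>a. z = a *\<^sub>R 1) \<or>
     (\<exists>i :: complex. i * i = - 1 \<and>
          (\<forall>a b. norm (a *\<^sub>R 1 + b *\<^sub>R i) = sqrt (a\<^sup>2 + b\<^sup>2)) \<and>
          (\<forall>z. \<exists>a b. z = a *\<^sub>R 1 + b *\<^sub>R i))"
    using 1 2 by (intro disjI2 exI[of _ \<i>]) auto
qed

text \<open>
  A Banach space over such a field: the class \<open>banach\<close> supplies the complete norm and the real
  scalar multiplication, which \<open>smul\<close> extends to the scalar field \<open>'k\<close>.
\<close>

locale banach_space_over = vector_space smul
  for smul :: "'k::real_or_complex_field \<Rightarrow> 'a::banach \<Rightarrow> 'a" +
  assumes norm_smul: "norm (smul c x) = norm c * norm x"
    and smul_of_real: "smul (of_real r) x = r *\<^sub>R x"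

lemma banach_space_over_real: "banach_space_over ((*\<^sub>R) :: real \<Rightarrow> 'a::banach \<Rightarrow> 'a)"
  by unfold_locales (auto simp: algebra_simps)

lemma banach_space_over_complex: "banach_space_over ((*) :: complex \<Rightarrow> complex \<Rightarrow> complex)"
  by unfold_locales (auto simp: algebra_simps norm_mult scaleR_conv_of_real)

definition infinite_dimensional :: "('k::real_or_complex_field \<Rightarrow> 'a::banach \<Rightarrow> 'a) \<Rightarrow> bool" where
  "infinite_dimensional smul \<longleftrightarrow> \<not> (\<exists>B. finite B \<and> module.span smul B = UNIV)"

definition continuous_dual ::
    "('k::real_or_complex_field \<Rightarrow> 'a::banach \<Rightarrow> 'a) \<Rightarrow> ('a \<Rightarrow> 'k) set" where
  "continuous_dual smul = {f. Vector_Spaces.linear smul (*) f \<and> continuous_on UNIV f}"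

definition weak_topology ::
    "('k::real_or_complex_field \<Rightarrow> 'a::banach \<Rightarrow> 'a) \<Rightarrow> 'a topology" where
  "weak_topology smul =
     topology_generated_by {f -` U | f U. f \<in> continuous_dual smul \<and> open U}"

definition relatively_weakly_compact ::
    "('k::real_or_complex_field \<Rightarrow> 'a::banach \<Rightarrow> 'a) \<Rightarrow> 'a set \<Rightarrow> bool" where
  "relatively_weakly_compact smul A \<longleftrightarrow>
     compactin (weak_topology smul) (weak_topology smul closure_of A)"

definition weakly_convergent ::
    "('k::real_or_complex_field \<Rightarrow> 'a::banach \<Rightarrow> 'a) \<Rightarrow> (nat \<Rightarrow> 'a) \<Rightarrow> bool" where
  "weakly_convergent smul y \<longleftrightarrow> (\<exists>l. limitin (weak_topology smul) y l sequentially)"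

text \<open>
  Sequences are indexed from \<open>0\<close>, so the block of indices \<open>k\<^bsub>n-1\<^esub> + 1, \<dots>, k\<^bsub>n\<^esub>\<close> of a sequence
  indexed from \<open>1\<close> becomes \<open>{k n..<k (Suc n)}\<close>.
\<close>

definition convex_block_subsequence :: "(nat \<Rightarrow> 'a::real_vector) \<Rightarrow> (nat \<Rightarrow> 'a) \<Rightarrow> bool" where
  "convex_block_subsequence y x \<longleftrightarrow>
     (\<exists>k :: nat \<Rightarrow> nat. strict_mono k \<and> k 0 = 0 \<and>
        (\<forall>n. y n \<in> convex hull (x ` {k n..<k (Suc n)})))"

end

theory Submission
  imports Defs
begin

text \<open>
  A sequence in a relatively weakly compact set has a weak cluster point; by Mazur's theorem it is a
  norm limit of convex combinations of every tail, which yields norm convergent convex blocks.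

  Conversely, if a bounded set \<open>A\<close> is not relatively weakly compact, then some \<open>\<phi>\<close> in the pointwise
  closure of \<open>A\<close> in the bidual has positive distance to the space. Helly's lemma then provides
  James' sequences: \<open>x\<^sub>n\<close> in \<open>A\<close> and \<open>f\<^sub>n\<close> in the dual ball with \<open>f\<^sub>n(x\<^sub>k) = 0\<close> for \<open>k < n\<close> and
  \<open>f\<^sub>n(x\<^sub>k) > d\<close> for \<open>k \<ge> n\<close>. A weak limit \<open>l\<close> of convex blocks would satisfy \<open>f\<^sub>n(l) \<ge> d\<close> for all \<open>n\<close>,
  although \<open>l\<close> is a norm limit of convex combinations, each annihilated by almost all \<open>f\<^sub>n\<close>.
\<close>

section \<open>Hahn--Banach\<close>

definition sublinear :: "('v::real_vector \<Rightarrow> real) \<Rightarrow> bool" where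
  "sublinear p \<longleftrightarrow> (\<forall>v w. p (v + w) \<le> p v + p w) \<and> (\<forall>t v. 0 \<le> t \<longrightarrow> p (t *\<^sub>R v) = t * p v)"

text \<open>One inequality for positive \<open>t\<close> suffices: applied with \<open>1 / t\<close>
  at \<open>t *\<^sub>R v\<close> it gives the reverse one.\<close>

lemma sublinearI:
  assumes add: "\<And>v w. p (v + w) \<le> p v + p w"
    and zero: "p 0 = 0"
    and scale: "\<And>t v. 0 < t \<Longrightarrow> p (t *\<^sub>R v) \<le> t * p v"
  shows "sublinear p"
  unfolding sublinear_def
proof (intro conjI allI impI add)
  fix t :: real and v
  assume "0 \<le> t"
  show "p (t *\<^sub>R v) = t * p v"
  proof (cases "t = 0")
    case False
    with \<open>0 \<le> t\<close> have t: "0 < t" by simp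
    have "p ((1 / t) *\<^sub>R (t *\<^sub>R v)) \<le> (1 / t) * p (t *\<^sub>R v)"
      by (rule scale) (use t in simp)
    then have "t * p v \<le> p (t *\<^sub>R v)"
      using t by (simp add: field_simps)
    with scale[OF t, of v] show ?thesis by linarith
  qed (simp add: zero)
qed

lemma sublinear_add: "sublinear p \<Longrightarrow> p (v + w) \<le> p v + p w"
  and sublinear_scale: "sublinear p \<Longrightarrow> 0 \<le> t \<Longrightarrow> p (t *\<^sub>R v) = t * p v"
  by (simp_all add: sublinear_def)

lemma sublinear_zero: "sublinear p \<Longrightarrow> p 0 = 0"
  using sublinear_scale[of p 0 0] by simp

lemma sublinear_minus: "sublinear p \<Longrightarrow> - p (- v) \<le> p v"
  using sublinear_add[of p v "- v"] by (simp add: sublinear_zero[of p])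

lemma sublinear_norm: "0 \<le> c \<Longrightarrow> sublinear (\<lambda>v::'v::real_normed_vector. c * norm v)"
  by (rule sublinearI) (auto simp: distrib_left[symmetric] intro: mult_left_mono norm_triangle_ineq)

text \<open>\<open>q v\<close> is the infimum of \<open>p (v - k) + r\<close> over
  \<open>(k, r)\<close> in \<open>K\<close>. The point \<open>(0, 0)\<close> gives
  \<open>q \<le> p\<close>, and the point \<open>(k, r)\<close> itself gives
  \<open>q k \<le> r\<close>. Closure of \<open>K\<close> under sums and positive multiples makes
  \<open>q\<close> sublinear.\<close>

lemma sublinear_inf_convolution:
  fixes p :: "'v::real_vector \<Rightarrow> real" and K :: "('v \<times> real) set"
  assumes p: "sublinear p" and K: "convex_cone K"
    and pos: "\<And>k r. (k, r) \<in> K \<Longrightarrow> 0 \<le> p (- k) + r"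
  obtains q where "sublinear q" "\<And>v. q v \<le> p v" "\<And>k r. (k, r) \<in> K \<Longrightarrow> q k \<le> r"
proof
  define h where "h v z = p (v - fst z) + snd z" for v and z :: "'v \<times> real"
  define q where "q v = (INF z\<in>K. h v z)" for v
  have K0: "0 \<in> K" using K by (rule convex_cone_contains_0)
  \<comment> \<open>This bound does not depend on \<open>z\<close>, so the infimum defining
    \<open>q v\<close> is taken over a set bounded below.\<close>
  have lower: "- p (- v) \<le> h v z" if "z \<in> K" for v z
  proof -
    have "p (- fst z) \<le> p (v - fst z) + p (- v)"
      using sublinear_add[OF p, of "v - fst z" "- v"] by simp
    moreover have "0 \<le> p (- fst z) + snd z" using pos[of "fst z" "snd z"] that by simp
    ultimately show ?thesis by (simp add: h_def)
  qed
  have bdd: "bdd_below (h v ` K)" for v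
    using lower by (intro bdd_belowI2)
  have q_le: "q v \<le> h v z" if "z \<in> K" for v z
    unfolding q_def by (rule cINF_lower[OF bdd that])
  have q_ge: "c \<le> q v" if "\<And>z. z \<in> K \<Longrightarrow> c \<le> h v z" for c v
    unfolding q_def using K0 that by (intro cINF_greatest) auto
  show q_le_p: "q v \<le> p v" for v
    using q_le[OF K0, of v] by (simp add: h_def)
  show "q k \<le> r" if "(k, r) \<in> K" for k r
    using q_le[OF that, of k] sublinear_zero[OF p] by (simp add: h_def)
  show "sublinear q"
  proof (rule sublinearI)
    fix v w
    have sum: "q (v + w) \<le> h v y + h w z" if "y \<in> K" "z \<in> K" for y z
    proof -
      have "q (v + w) \<le> h (v + w) (y + z)"
        by (rule q_le) (use K that in \<open>simp add: convex_cone_add\<close>)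
      also have "\<dots> \<le> h v y + h w z"
        using sublinear_add[OF p, of "v - fst y" "w - fst z"] by (simp add: h_def algebra_simps)
      finally show ?thesis .
    qed
    \<comment> \<open>The two infima are taken one after the other: over \<open>y\<close> with
      \<open>z\<close> fixed, then over \<open>z\<close>.\<close>
    have "q (v + w) - h w z \<le> q v" if "z \<in> K" for z
      using sum that by (intro q_ge) (simp add: le_diff_eq add.commute diff_le_eq)
    then have "q (v + w) - q v \<le> q w"
      by (intro q_ge) (simp add: algebra_simps)
    then show "q (v + w) \<le> q v + q w" by simp
  next
    have "0 \<le> q 0"
      using lower[of _ 0] by (intro q_ge) (simp add: sublinear_zero[OF p])
    then show "q 0 = 0"
      using q_le_p[of 0] by (simp add: sublinear_zero[OF p])
  next
    fix t :: real and v
    assume t: "0 < t"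
    have "q (t *\<^sub>R v) / t \<le> h v z" if "z \<in> K" for z
    proof -
      have "q (t *\<^sub>R v) \<le> h (t *\<^sub>R v) (t *\<^sub>R z)"
        by (rule q_le) (use K that t in \<open>simp add: convex_cone_scaleR\<close>)
      also have "\<dots> = t * h v z"
        using sublinear_scale[OF p, of t "v - fst z"] t
        by (simp add: h_def scaleR_diff_right distrib_left)
      finally show ?thesis using t by (simp add: field_simps)
    qed
    then have "q (t *\<^sub>R v) / t \<le> q v" by (rule q_ge)
    then show "q (t *\<^sub>R v) \<le> t * q v" using t by (simp add: field_simps)
  qed
qed

text \<open>The pointwise infimum works: the common majorant \<open>p\<close> keeps it finite, and
  for subadditivity two members of the chain are replaced by the smaller one.\<close>

lemma sublinear_chain_Inf:
  assumes "C \<noteq> {}" and sub: "\<And>f. f \<in> C \<Longrightarrow> sublinear f"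
    and le: "\<And>f v. f \<in> C \<Longrightarrow> f v \<le> p v"
    and chain: "\<And>f g. f \<in> C \<Longrightarrow> g \<in> C \<Longrightarrow> f \<le> g \<or> g \<le> f"
  obtains u where "sublinear u" "\<And>f. f \<in> C \<Longrightarrow> u \<le> f"
proof
  define u where "u v = (INF f\<in>C. f v)" for v
  have lower: "- p (- v) \<le> f v" if "f \<in> C" for f v
    using sublinear_minus[OF sub[OF that], of v] le[OF that, of "- v"] by linarith
  then have bdd: "bdd_below ((\<lambda>f. f v) ` C)" for v
    by (intro bdd_belowI2)
  have u_le: "u v \<le> f v" if "f \<in> C" for f v
    unfolding u_def by (rule cINF_lower[OF bdd that])
  have u_ge: "c \<le> u v" if "\<And>f. f \<in> C \<Longrightarrow> c \<le> f v" for c v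
    unfolding u_def using assms(1) that by (rule cINF_greatest)
  show "u \<le> f" if "f \<in> C" for f using u_le[OF that] by (simp add: le_fun_def)
  show "sublinear u"
  proof (rule sublinearI)
    fix v w
    have sum: "u (v + w) \<le> f v + g w" if fg: "f \<in> C" "g \<in> C" for f g
    proof -
      obtain m where m: "m \<in> C" "m \<le> f" "m \<le> g" using chain[OF fg] fg by blast
      have "u (v + w) \<le> m v + m w"
        using u_le[OF m(1), of "v + w"] sublinear_add[OF sub[OF m(1)], of v w] by linarith
      with le_funD[OF m(2), of v] le_funD[OF m(3), of w] show ?thesis by linarith
    qed
    have "u (v + w) - g w \<le> u v" if "g \<in> C" for g
      using sum that by (intro u_ge) (simp add: diff_le_eq)
    then have "u (v + w) - u v \<le> u w"
      by (intro u_ge) (simp add: algebra_simps)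
    then show "u (v + w) \<le> u v + u w" by simp
  next
    obtain f where f: "f \<in> C" using assms(1) by blast
    have "0 \<le> u 0"
      by (rule u_ge) (metis order_refl sub sublinear_zero)
    then show "u 0 = 0"
      using u_le[OF f, of 0] sublinear_zero[OF sub[OF f]] by simp
  next
    fix t :: real and v
    assume t: "0 < t"
    have "u (t *\<^sub>R v) / t \<le> f v" if "f \<in> C" for f
      using u_le[OF that, of "t *\<^sub>R v"] sublinear_scale[OF sub[OF that], of t v] t
      by (simp add: field_simps)
    then have "u (t *\<^sub>R v) / t \<le> u v" by (rule u_ge)
    then show "u (t *\<^sub>R v) \<le> t * u v" using t by (simp add: field_simps)
  qed
qed

lemma convex_cone_cone_hull:
  assumes "convex S" "S \<noteq> {}"
  shows "convex_cone (cone hull S)"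
  using assms by (simp add: convex_cone_def conic_def convex_cone_hull mem_cone[OF cone_cone_hull] cone_hull_empty_iff[symmetric])

text \<open>Zorn's lemma gives a minimal sublinear functional \<open>m\<close> below
  \<open>p\<close>. Minimality forces \<open>m\<close> to be odd, and an odd sublinear functional is
  linear.\<close>

lemma sublinear_dominates_linear:
  fixes p :: "'v::real_vector \<Rightarrow> real"
  assumes p: "sublinear p"
  obtains g where "linear g" "\<And>v. g v \<le> p v"
proof -
  define S where "S = {q. sublinear q \<and> q \<le> p}"
  \<comment> \<open>Zorn's lemma is applied to the reversed order, so upper bounds of chains are
    lower bounds of functionals.\<close>
  have "\<exists>m\<in>S. \<forall>a\<in>S. a \<le> m \<longrightarrow> a = m"
  proof (rule predicate_Zorn)
    show "partial_order_on S (relation_of (\<lambda>f g. g \<le> f) S)"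
      by (auto simp: partial_order_on_def preorder_on_def refl_on_def trans_def antisym_def
          relation_of_def)
  next
    fix C assume C: "C \<in> Chains (relation_of (\<lambda>f g. g \<le> f) S)"
    show "\<exists>u\<in>S. \<forall>f\<in>C. u \<le> f"
    proof (cases "C = {}")
      case True
      then show ?thesis using p by (auto simp: S_def)
    next
      case False
      have ch: "f \<le> g \<or> g \<le> f" if "f \<in> C" "g \<in> C" for f g
        using C that by (auto simp: Chains_def relation_of_def)
      have CS: "C \<subseteq> S" using C by (auto simp: Chains_def relation_of_def)
      obtain u where u: "sublinear u" "\<And>f. f \<in> C \<Longrightarrow> u \<le> f"
      proof (rule sublinear_chain_Inf[OF False, of p])
        show "sublinear f" "f v \<le> p v" if "f \<in> C" for f v
          using CS that by (auto simp: S_def le_fun_def)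
      qed (use ch in blast)+
      moreover from False obtain f where "f \<in> C" by blast
      then have "u \<le> p" using u(2) CS by (auto simp: S_def intro: order_trans)
      ultimately show ?thesis by (auto simp: S_def)
    qed
  qed
  then obtain m where "m \<in> S" and minS: "\<And>q. q \<in> S \<Longrightarrow> q \<le> m \<Longrightarrow> q = m"
    by blast
  then have m: "sublinear m" "m \<le> p" by (simp_all add: S_def)
  have min: "q = m" if "sublinear q" "q \<le> m" for q
    using minS[of q] that m(2) by (simp add: S_def order_trans)
  have odd: "m (- y) = - m y" for y
  proof -
    \<comment> \<open>Convolving \<open>m\<close> with this ray yields a sublinear
      \<open>q \<le> m\<close> with \<open>q (- y) \<le> - m y\<close>, and minimality identifies
      \<open>q\<close> with \<open>m\<close>.\<close>
    let ?K = "cone hull {(- y, - m y)}"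
    have K: "convex_cone ?K" by (intro convex_cone_cone_hull) auto
    have "0 \<le> m (- k) + r" if "(k, r) \<in> ?K" for k r
      using that sublinear_scale[OF m(1), of _ y] by (auto simp: cone_hull_expl)
    then obtain q where q: "sublinear q" "\<And>v. q v \<le> m v" "\<And>k r. (k, r) \<in> ?K \<Longrightarrow> q k \<le> r"
      using sublinear_inf_convolution[OF m(1) K] by blast
    have "q = m" using q by (intro min) (auto simp: le_fun_def)
    moreover have "(- y, - m y) \<in> ?K" by (simp add: hull_inc)
    ultimately have "m (- y) \<le> - m y" using q(3) by blast
    with sublinear_minus[OF m(1), of y] show ?thesis by linarith
  qed
  have "linear m"
  proof (rule linearI)
    fix v w
    show "m (v + w) = m v + m w"
      using sublinear_add[OF m(1), of v w] sublinear_add[OF m(1), of "- v" "- w"]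
        odd[of v] odd[of w] odd[of "v + w"] by simp
  next
    fix t :: real and v
    show "m (t *\<^sub>R v) = t *\<^sub>R m v"
    proof (cases "0 \<le> t")
      case True
      then show ?thesis by (simp add: sublinear_scale[OF m(1)])
    next
      case False
      then show ?thesis
        using sublinear_scale[OF m(1), of "- t" v] odd[of "t *\<^sub>R v"] by simp
    qed
  qed
  then show ?thesis using m(2) by (intro that) (auto simp: le_fun_def)
qed

section \<open>The Mazur-Orlicz theorem, extension and separation\<close>

text \<open>The constraints in \<open>K\<close> are first absorbed into a smaller sublinear
  functional, below which any linear one will do. Extension and separation both follow by a choice
  of \<open>K\<close>.\<close>

lemma Mazur_Orlicz:
  fixes p :: "'v::real_vector \<Rightarrow> real" and K :: "('v \<times> real) set"
  assumes "sublinear p" "convex_cone K" "\<And>k r. (k, r) \<in> K \<Longrightarrow> 0 \<le> p (- k) + r"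
  obtains g where "linear g" "\<And>v. g v \<le> p v" "\<And>k r. (k, r) \<in> K \<Longrightarrow> g k \<le> r"
proof -
  obtain q where q: "sublinear q" "\<And>v. q v \<le> p v" "\<And>k r. (k, r) \<in> K \<Longrightarrow> q k \<le> r"
    using sublinear_inf_convolution[OF assms] by blast
  obtain g where "linear g" "\<And>v. g v \<le> q v"
    using sublinear_dominates_linear[OF q(1)] by blast
  with q that show ?thesis by (meson order_trans)
qed

lemma linear_le_norm_imp_abs_le:
  fixes g :: "'v::real_normed_vector \<Rightarrow> real"
  assumes "linear g" "\<And>v. g v \<le> c * norm v"
  shows "\<bar>g v\<bar> \<le> c * norm v"
  using assms(2)[of v] assms(2)[of "- v"] linear_neg[OF assms(1), of v] by (simp add: abs_le_iff)

text \<open>Take for \<open>K\<close> the graph of \<open>f\<close> over \<open>S\<close>. This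
  gives \<open>g \<le> f\<close> on \<open>S\<close>, and passing from \<open>s\<close> to
  \<open>- s\<close> turns it into equality.\<close>

lemma Hahn_Banach_extension:
  fixes f :: "'v::real_normed_vector \<Rightarrow> real"
  assumes S: "subspace S" and f: "linear f" and c: "0 \<le> c"
    and le: "\<And>s. s \<in> S \<Longrightarrow> f s \<le> c * norm s"
  obtains g where "linear g" "\<And>v. \<bar>g v\<bar> \<le> c * norm v" "\<And>s. s \<in> S \<Longrightarrow> g s = f s"
proof -
  let ?K = "(\<lambda>s. (s, f s)) ` S"
  have "linear (\<lambda>s. (s, f s))"
    by (rule linearI) (simp_all add: linear_add[OF f] linear_scale[OF f])
  then have K: "convex_cone ?K"
    using S by (intro convex_cone_linear_image conjI)
      (auto simp: convex_cone_iff subspace_0 subspace_add subspace_scale)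
  have "0 \<le> c * norm (- k) + r" if "(k, r) \<in> ?K" for k r
    using le[of "- k"] that S by (auto simp: linear_neg[OF f] subspace_neg)
  then obtain g where g: "linear g" "\<And>v. g v \<le> c * norm v" "\<And>k r. (k, r) \<in> ?K \<Longrightarrow> g k \<le> r"
    using Mazur_Orlicz[OF sublinear_norm[OF c] K] by blast
  have le: "g s \<le> f s" if "s \<in> S" for s using g(3) that by blast
  have "g s = f s" if "s \<in> S" for s
    using le[OF that] le[of "- s"] that S
    by (simp add: subspace_neg linear_neg[OF f] linear_neg[OF g(1)])
  with g linear_le_norm_imp_abs_le[OF g(1,2)] that show ?thesis by blast
qed

text \<open>Apply \<open>Mazur_Orlicz\<close> to the norm and the cone spanned by \<open>(C - l) \<times> {- d}\<close>.\<close>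

lemma Mazur_separation:
  fixes C :: "'v::real_normed_vector set"
  assumes C: "convex C" "C \<noteq> {}" and d: "\<And>c. c \<in> C \<Longrightarrow> d \<le> norm (c - l)"
  obtains g :: "'v \<Rightarrow>\<^sub>L real" where "norm g \<le> 1"
    "\<And>c. c \<in> C \<Longrightarrow> blinfun_apply g c \<le> blinfun_apply g l - d"
proof -
  let ?D = "(\<lambda>c. (c - l, - d)) ` C"
  have "?D = (\<lambda>z. (- l, - d) + z) ` (C \<times> {0})" by force
  then have "convex ?D"
    using convex_translation[OF convex_Times[OF C(1) convex_singleton[of "0::real"]], of "(- l, - d)"]
    by simp
  then have K: "convex_cone (cone hull ?D)"
    using C(2) by (intro convex_cone_cone_hull) auto
  \<comment> \<open>At \<open>t *\<^sub>R (c - l, - d)\<close> this reads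
    \<open>t * d \<le> t * norm (c - l)\<close>.\<close>
  have "0 \<le> 1 * norm (- k) + r" if kr: "(k, r) \<in> cone hull ?D" for k r
  proof -
    obtain t c where tc: "0 \<le> t" "c \<in> C" "k = t *\<^sub>R (c - l)" "r = - (t * d)"
      using kr by (force simp: cone_hull_expl)
    with mult_left_mono[OF d[OF tc(2)] tc(1)] show ?thesis by simp
  qed
  then obtain g where g: "linear g" "\<And>v. g v \<le> 1 * norm v"
    "\<And>k r. (k, r) \<in> cone hull ?D \<Longrightarrow> g k \<le> r"
    using Mazur_Orlicz[OF sublinear_norm[OF zero_le_one] K] by blast
  note abs = linear_le_norm_imp_abs_le[OF g(1,2)]
  have bl: "bounded_linear g"
    using abs g(1) by (intro bounded_linear_intro[where K=1]) (auto simp: linear_add linear_scale)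
  have "g c \<le> g l - d" if "c \<in> C" for c
  proof -
    have "(c - l, - d) \<in> cone hull ?D" using that by (intro hull_inc) auto
    then have "g (c - l) \<le> - d" by (rule g(3))
    then show ?thesis by (simp add: linear_diff[OF g(1)])
  qed
  moreover have "norm (Blinfun g) \<le> 1"
    using abs by (intro norm_blinfun_bound) (auto simp: bounded_linear_Blinfun_apply[OF bl])
  ultimately show ?thesis
    using that[of "Blinfun g"] by (simp add: bounded_linear_Blinfun_apply[OF bl])
qed

text \<open>Separate \<open>x\<close> from the set \<open>{0}\<close>, whose distance to
  \<open>x\<close> is \<open>norm x\<close>.\<close>

lemma norming_functional:
  fixes x :: "'v::real_normed_vector"
  obtains g :: "'v \<Rightarrow>\<^sub>L real" where "norm g \<le> 1" "norm x \<le> blinfun_apply g x"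
proof -
  obtain g :: "'v \<Rightarrow>\<^sub>L real" where "norm g \<le> 1" "blinfun_apply g 0 \<le> blinfun_apply g x - norm x"
    using Mazur_separation[of "{0}" "norm x" x] by auto
  with that show ?thesis by (simp add: blinfun.zero_right)
qed

text \<open>Mazur's theorem as a criterion: a point at distance \<open>d > 0\<close> from the hull
  would be separated by a \<open>g\<close> with \<open>g b \<le> g l - d\<close> on
  \<open>B\<close>, against the approximation with \<open>e = d\<close>.\<close>

lemma mem_closure_convex_hullI:
  fixes l :: "'v::real_normed_vector"
  assumes B: "B \<noteq> {}"
    and approx: "\<And>(g :: 'v \<Rightarrow>\<^sub>L real) e. 0 < e \<Longrightarrow> \<exists>b\<in>B. blinfun_apply g l - e < blinfun_apply g b"
  shows "l \<in> closure (convex hull B)"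
proof (rule ccontr)
  assume "l \<notin> closure (convex hull B)"
  then obtain d where d: "0 < d" "\<And>c. c \<in> convex hull B \<Longrightarrow> d \<le> norm (c - l)"
    unfolding closure_approachable dist_norm by (meson not_less)
  obtain g :: "'v \<Rightarrow>\<^sub>L real" where
    g: "\<And>c. c \<in> convex hull B \<Longrightarrow> blinfun_apply g c \<le> blinfun_apply g l - d"
  proof (rule Mazur_separation)
    show "convex hull B \<noteq> {}" using B by simp
  qed (use d(2) in auto)
  obtain b where "b \<in> B" "blinfun_apply g l - d < blinfun_apply g b"
    using approx[OF d(1), of g] by blast
  with g[of b] show False by (simp add: hull_inc)
qed

section \<open>The weak topology\<close>

lemma linear_continuous_imp_bounded_linear:
  fixes h :: "'v::real_normed_vector \<Rightarrow> 'w::real_normed_vector"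
  assumes h: "linear h" and cont: "continuous_on UNIV h"
  shows "bounded_linear h"
proof -
  have "isCont h 0" using cont by (simp add: continuous_on_eq_continuous_at)
  then obtain d where d: "0 < d" "\<And>x. norm x < d \<Longrightarrow> norm (h x) < 1"
    unfolding continuous_at_eps_delta
    by (metis dist_0_norm dist_commute h linear_0 zero_less_one)
  have "norm (h x) \<le> norm x * (2 / d)" for x
  proof (cases "x = 0")
    case False
    \<comment> \<open>The rescaled vector has norm \<open>d / 2\<close>, whence the constant
      \<open>2 / d\<close>.\<close>
    have "norm (h ((d / (2 * norm x)) *\<^sub>R x)) < 1"
      using d(1) False by (intro d(2)) simp
    then show ?thesis
      using d(1) False by (simp add: linear_scale[OF h] field_simps)
  qed (simp add: linear_0[OF h])
  then show ?thesis
    using h by (intro bounded_linear_intro[where K = "2 / d"]) (auto simp: linear_add linear_scale)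
qed

text \<open>Treats both scalar fields uniformly. Over the reals \<open>im\<close> and
  \<open>i\<close> are zero; otherwise \<open>i\<close> is the imaginary unit. The last clause lets
  later computations either drop the \<open>im\<close> terms or use
  \<open>i * i = - 1\<close>.\<close>

lemma scalar_coordinates:
  obtains re im :: "'k::real_or_complex_field \<Rightarrow> real" and i
  where "bounded_linear re" "bounded_linear im" "\<And>z. z = re z *\<^sub>R 1 + im z *\<^sub>R i"
    "re 1 = 1" "re i = 0" "\<And>z. im z = 0 \<or> i * i = - 1"
  using real_or_complex
proof
  assume "\<forall>z::'k. \<exists>a. z = a *\<^sub>R 1"
  then obtain re where re: "z = re z *\<^sub>R (1::'k)" for z by metis
  have uniq: "re z = a" if "z = a *\<^sub>R (1::'k)" for a z
    using re[of z] that by (metis one_neq_zero scaleR_right_imp_eq)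
  have "bounded_linear re"
  proof (rule bounded_linear_intro[where K = 1])
    show "re (x + y) = re x + re y" for x y
      by (rule uniq) (metis re scaleR_add_left)
    show "re (t *\<^sub>R x) = t *\<^sub>R re x" for t x
      by (rule uniq) (metis re real_scaleR_def scaleR_scaleR)
    show "norm (re x) \<le> norm x * 1" for x
      by (subst (2) re) simp
  qed
  then show thesis
    using re by (intro that[of re "\<lambda>_. 0" 0]) (auto intro: uniq)
next
  assume "\<exists>i::'k. i * i = - 1 \<and> (\<forall>a b. norm (a *\<^sub>R 1 + b *\<^sub>R i) = sqrt (a\<^sup>2 + b\<^sup>2)) \<and>
          (\<forall>z. \<exists>a b. z = a *\<^sub>R 1 + b *\<^sub>R i)"
  then obtain i :: 'k where i: "i * i = - 1"
    and norm: "\<And>a b. norm (a *\<^sub>R 1 + b *\<^sub>R i) = sqrt (a\<^sup>2 + b\<^sup>2)"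
    and ex: "\<forall>z. \<exists>a b. z = a *\<^sub>R 1 + b *\<^sub>R i" by blast
  from ex obtain re im where reim: "z = re z *\<^sub>R 1 + im z *\<^sub>R i" for z by metis
  \<comment> \<open>The norm formula makes \<open>1\<close> and \<open>i\<close> independent over
    the reals; uniqueness of coordinates then gives linearity of \<open>re\<close> and
    \<open>im\<close>.\<close>
  have uniq: "re z = a \<and> im z = b" if "z = a *\<^sub>R 1 + b *\<^sub>R i" for a b z
  proof -
    have "(re z - a) *\<^sub>R 1 + (im z - b) *\<^sub>R i = 0"
      using reim[of z] that by (simp add: scaleR_diff_left algebra_simps)
    then have "sqrt ((re z - a)\<^sup>2 + (im z - b)\<^sup>2) = 0"
      using norm by (metis norm_zero)
    then show ?thesis by (simp add: sum_power2_eq_zero_iff)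
  qed
  have add: "re (x + y) = re x + re y \<and> im (x + y) = im x + im y" for x y
    by (rule uniq) (subst reim[of x], subst reim[of y], simp add: scaleR_add_left)
  have scale: "re (t *\<^sub>R x) = t * re x \<and> im (t *\<^sub>R x) = t * im x" for t x
    by (rule uniq) (subst reim[of x], simp add: scaleR_add_right)
  have bound: "\<bar>re x\<bar> \<le> norm x \<and> \<bar>im x\<bar> \<le> norm x" for x
    by (subst (2 4) reim) (simp add: norm)
  show thesis
  proof (rule that[of re im i])
    show "bounded_linear re" "bounded_linear im"
      using add scale bound by (auto intro!: bounded_linear_intro[where K = 1])
    show "re 1 = 1" "re i = 0" using uniq[of 1 1 0] uniq[of i 0 1] by simp_all
  qed (use reim i in auto)
qed

text \<open>The canonical embedding into the bidual, with values in the full function space so that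
  its product topology and Tychonoff's theorem apply. The functionals are real ones over either
  scalar field.\<close>

definition evaluation :: "'v::real_normed_vector \<Rightarrow> ('v \<Rightarrow>\<^sub>L real) \<Rightarrow> real" where
  "evaluation x g = blinfun_apply g x"

lemma continuous_evaluation: "continuous_on UNIV evaluation"
  unfolding evaluation_def[abs_def]
  by (intro continuous_on_coordinatewise_then_product) (intro continuous_intros)

context banach_space_over
begin

text \<open>The real and imaginary parts of \<open>f\<close> are bounded real functionals. Together
  with the next lemma this shows that real functionals generate the same weak topology.\<close>

lemma continuous_dual_real_coordinates:
  assumes "f \<in> continuous_dual smul"
  obtains a u b v where
    "f = (\<lambda>x. blinfun_apply a x *\<^sub>R u + blinfun_apply b x *\<^sub>R v)"
proof -
  from assms interpret f: Vector_Spaces.linear smul "(*)" f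
    by (simp add: continuous_dual_def)
  have cont: "continuous_on UNIV f"
    using assms by (simp add: continuous_dual_def)
  have "linear f"
    by (rule linearI)
      (use f.scale[of "of_real _"] in \<open>simp_all add: f.add smul_of_real scaleR_conv_of_real\<close>)
  then have f: "bounded_linear f"
    using cont by (rule linear_continuous_imp_bounded_linear)
  obtain re im :: "'k \<Rightarrow> real" and i where re: "bounded_linear re" and im: "bounded_linear im"
    and coord: "\<And>z. z = re z *\<^sub>R 1 + im z *\<^sub>R i"
    using scalar_coordinates by metis
  have "f x = blinfun_apply (Blinfun (\<lambda>x. re (f x))) x *\<^sub>R 1
      + blinfun_apply (Blinfun (\<lambda>x. im (f x))) x *\<^sub>R i" for x
    using coord[of "f x"] bounded_linear_compose[OF re f] bounded_linear_compose[OF im f]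
    by (simp add: bounded_linear_Blinfun_apply)
  then show ?thesis by (intro that ext)
qed

text \<open>The functional \<open>g x - i g (i x)\<close> is linear over the scalar field and has
  real part \<open>g\<close>; over the reals \<open>i = 0\<close> and it is \<open>g\<close>
  itself.\<close>

lemma blinfun_factors_through_continuous_dual:
  fixes g :: "'a \<Rightarrow>\<^sub>L real"
  obtains f r where "f \<in> continuous_dual smul" "continuous_on UNIV r" "blinfun_apply g = r \<circ> f"
proof -
  obtain re im :: "'k \<Rightarrow> real" and i where re: "bounded_linear re"
    and coord: "\<And>z. z = re z *\<^sub>R 1 + im z *\<^sub>R i" and re1: "re 1 = 1" and rei: "re i = 0"
    and i: "\<And>z. im z = 0 \<or> i * i = - 1"
    using scalar_coordinates by metis
  define f where "f x = blinfun_apply g x *\<^sub>R 1 - blinfun_apply g (smul i x) *\<^sub>R i" for x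
  have smul_i: "bounded_linear (smul i)"
  proof (rule bounded_linear_intro[where K = "norm i"])
    show "smul i (t *\<^sub>R x) = t *\<^sub>R smul i x" for t x
      by (simp add: smul_of_real[symmetric] mult.commute)
  qed (simp_all add: scale_right_distrib norm_smul mult.commute)
  \<comment> \<open>Expanding \<open>c\<close> in real coordinates reduces this to real linearity of
    \<open>g\<close>; the \<open>im c\<close> terms vanish or are rewritten by
    \<open>i * i = - 1\<close>.\<close>
  have scale: "f (smul c x) = c * f x" for c x
  proof -
    have c: "smul c y = re c *\<^sub>R y + im c *\<^sub>R smul i y" for y
      using arg_cong[OF coord[of c], of "\<lambda>c. smul c y"]
      by (simp add: scale_left_distrib scaleR_conv_of_real smul_of_real
          scale_scale[symmetric] del: scale_scale)
    have ic: "smul i (smul c x) = re c *\<^sub>R smul i x - im c *\<^sub>R x"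
      using i[of c] c[of "smul i x"] by (auto simp: mult.commute[of i c])
    have "c * f x = (re c *\<^sub>R 1 + im c *\<^sub>R i) * f x" using coord[of c] by simp
    also have "\<dots> = f (smul c x)"
      unfolding f_def ic unfolding c using i[of c]
      by (auto simp: blinfun.add_right blinfun.diff_right blinfun.scaleR_right algebra_simps
          scaleR_add_left scaleR_diff_left)
    finally show ?thesis ..
  qed
  have "Vector_Spaces.linear smul (*) f"
  proof
    show "f (x + y) = f x + f y" for x y
      by (simp add: f_def blinfun.add_right scale_right_distrib scaleR_add_left)
  qed (simp_all add: scale algebra_simps)
  moreover have "continuous_on UNIV f"
    unfolding f_def[abs_def]
    using linear_continuous_on[OF smul_i, of UNIV] by (intro continuous_intros)
  moreover have "blinfun_apply g = re \<circ> f"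
    by (simp add: fun_eq_iff f_def bounded_linear.linear[OF re] linear_diff linear_scale re1 rei)
  moreover have "continuous_on UNIV re" using re by (rule linear_continuous_on)
  ultimately show ?thesis using that by (auto simp: continuous_dual_def)
qed

section \<open>Weakly open sets, weak limits and convex hulls\<close>

lemma openin_weak_topology_vimage:
  fixes g :: "'a \<Rightarrow>\<^sub>L real"
  assumes "open U"
  shows "openin (weak_topology smul) (blinfun_apply g -` U)"
proof -
  obtain f r where f: "f \<in> continuous_dual smul" and r: "continuous_on UNIV r"
    and g: "blinfun_apply g = r \<circ> f"
    by (rule blinfun_factors_through_continuous_dual)
  have "blinfun_apply g -` U = f -` (r -` U)" by (auto simp: g)
  moreover have "open (r -` U)" using assms r by (rule open_vimage)
  ultimately show ?thesis
    unfolding weak_topology_def using f by (intro topology_generated_by_Basis) blast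
qed

lemma topspace_weak_topology [simp]: "topspace (weak_topology smul) = UNIV"
  using openin_subset[OF openin_weak_topology_vimage[OF open_UNIV, of 0]] by auto

text \<open>The weak topology is induced by \<open>evaluation\<close> from the product topology, so
  weak compactness can be studied in the product space.\<close>

lemma openin_weak_topology_iff:
  "openin (weak_topology smul) S \<longleftrightarrow> (\<exists>V. open V \<and> evaluation -` V = S)"
proof
  assume "openin (weak_topology smul) S"
  then have "generate_topology_on {f -` U | f U. f \<in> continuous_dual smul \<and> open U} S"
    by (simp add: weak_topology_def openin_topology_generated_by)
  then show "\<exists>V. open V \<and> evaluation -` V = S"
  proof induction
    case Empty
    then show ?case by (intro exI[of _ "{}"]) simp
  next
    case (Int S T)
    then obtain V W where "open V" "evaluation -` V = S" "open W" "evaluation -` W = T" by blast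
    then show ?case by (intro exI[of _ "V \<inter> W"]) auto
  next
    case (UN K)
    then have "\<forall>S\<in>K. \<exists>V. open V \<and> evaluation -` V = S" by auto
    from bchoice[OF this] obtain V where "\<forall>S\<in>K. open (V S) \<and> evaluation -` V S = S"
      by blast
    then show ?case by (intro exI[of _ "\<Union> (V ` K)"]) blast
  next
    case (Basis S)
    then obtain f U where f: "f \<in> continuous_dual smul" and U: "open U" and S: "S = f -` U"
      by blast
    obtain a u b v where ab: "f = (\<lambda>x. blinfun_apply a x *\<^sub>R u + blinfun_apply b x *\<^sub>R v)"
      by (rule continuous_dual_real_coordinates[OF f])
    \<comment> \<open>\<open>?e\<close> recovers \<open>f x\<close> from \<open>evaluation x\<close>
      and is continuous, since it depends on the two coordinates \<open>a\<close> and
      \<open>b\<close> alone.\<close>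
    let ?e = "\<lambda>\<phi>. \<phi> a *\<^sub>R u + \<phi> b *\<^sub>R v"
    have coord: "continuous_on UNIV (\<lambda>\<phi> :: ('a \<Rightarrow>\<^sub>L real) \<Rightarrow> real. \<phi> g)" for g
      by (rule continuous_on_product_coordinates)
    have "continuous_on UNIV ?e"
      by (rule continuous_on_add[OF continuous_on_scaleR[OF coord continuous_on_const]
            continuous_on_scaleR[OF coord continuous_on_const]])
    with U have "open (?e -` U)" by (rule open_vimage)
    moreover have "evaluation -` (?e -` U) = S" by (auto simp: S ab evaluation_def)
    ultimately show ?case by blast
  qed
next
  assume "\<exists>V. open V \<and> evaluation -` V = S"
  then obtain V where V: "open V" "evaluation -` V = S" by blast
  have "continuous_map (weak_topology smul) euclidean (\<lambda>x. evaluation x g)" for g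
    using openin_weak_topology_vimage[of _ g]
    by (simp add: continuous_map_def evaluation_def vimage_def)
  then have "continuous_map (weak_topology smul) euclidean evaluation"
    unfolding euclidean_product_topology[symmetric] continuous_map_componentwise_UNIV by blast
  from openin_continuous_map_preimage[OF this, of V] V
  show "openin (weak_topology smul) S" by (simp add: vimage_def)
qed

lemma limitin_weak_topologyI:
  assumes "y \<longlonglongrightarrow> l"
  shows "limitin (weak_topology smul) y l sequentially"
  unfolding limitin_def
proof (intro conjI allI impI)
  fix S assume S: "openin (weak_topology smul) S \<and> l \<in> S"
  then obtain V where V: "open V" "evaluation -` V = S"
    by (auto simp: openin_weak_topology_iff)
  have "open S"
    using open_vimage[OF V(1) continuous_evaluation] V(2) by simp
  with assms show "\<forall>\<^sub>F n in sequentially. y n \<in> S"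
    using S by (intro topological_tendstoD) auto
qed simp

lemma limitin_weak_topologyD:
  fixes g :: "'a \<Rightarrow>\<^sub>L real"
  assumes "limitin (weak_topology smul) y l sequentially"
  shows "(\<lambda>n. blinfun_apply g (y n)) \<longlonglongrightarrow> blinfun_apply g l"
proof (rule topological_tendstoI)
  fix U :: "real set" assume "open U" "blinfun_apply g l \<in> U"
  with openin_weak_topology_vimage[of U g]
  have "openin (weak_topology smul) (blinfun_apply g -` U)" "l \<in> blinfun_apply g -` U"
    by simp_all
  with assms have "\<forall>\<^sub>F n in sequentially. y n \<in> blinfun_apply g -` U"
    unfolding limitin_def by blast
  then show "\<forall>\<^sub>F n in sequentially. blinfun_apply g (y n) \<in> U" by simp
qed

text \<open>Each half-space \<open>g > g l - e\<close> is a weak neighbourhood of \<open>l\<close>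
  and so meets \<open>B\<close>; Mazur's criterion applies.\<close>

lemma weak_closure_subset_closure_convex_hull:
  "weak_topology smul closure_of B \<subseteq> closure (convex hull B)"
proof
  fix l assume l: "l \<in> weak_topology smul closure_of B"
  show "l \<in> closure (convex hull B)"
  proof (rule mem_closure_convex_hullI)
    show "B \<noteq> {}"
    proof
      assume "B = {}"
      with l show False by (simp only: closure_of_empty empty_iff)
    qed
  next
    fix g :: "'a \<Rightarrow>\<^sub>L real" and e :: real
    assume "0 < e"
    then have "l \<in> blinfun_apply g -` {blinfun_apply g l - e<..}" by simp
    moreover have "openin (weak_topology smul) (blinfun_apply g -` {blinfun_apply g l - e<..})"
      by (rule openin_weak_topology_vimage) simp
    ultimately obtain b where "b \<in> B" "b \<in> blinfun_apply g -` {blinfun_apply g l - e<..}"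
      using l unfolding in_closure_of by meson
    then show "\<exists>b\<in>B. blinfun_apply g l - e < blinfun_apply g b" by (intro bexI[of _ b]) simp_all
  qed
qed

lemma weak_limit_in_closure_convex_hull:
  assumes "limitin (weak_topology smul) y l sequentially"
  shows "l \<in> closure (convex hull (range y))"
proof (rule mem_closure_convex_hullI)
  fix g :: "'a \<Rightarrow>\<^sub>L real" and e :: real
  assume "0 < e"
  then have "blinfun_apply g l - e < blinfun_apply g l" by simp
  with limitin_weak_topologyD[OF assms]
  have "\<forall>\<^sub>F n in sequentially. blinfun_apply g l - e < blinfun_apply g (y n)"
    by (rule order_tendstoD(1))
  then show "\<exists>b\<in>range y. blinfun_apply g l - e < blinfun_apply g b"
    by (auto simp: eventually_sequentially)
qed simp

end

section \<open>The canonical image in the algebraic bidual\<close>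

lemma evaluation_add [simp]: "evaluation (x + y) g = evaluation x g + evaluation y g"
  and evaluation_scaleR [simp]: "evaluation (t *\<^sub>R x) g = t * evaluation x g"
  by (simp_all add: evaluation_def blinfun.add_right blinfun.scaleR_right)

lemma linear_evaluation: "linear (evaluation x)"
  by (rule linearI) (simp_all add: evaluation_def blinfun.add_left blinfun.scaleR_left)

definition annihilator :: "'v::real_normed_vector set \<Rightarrow> ('v \<Rightarrow>\<^sub>L real) set" where
  "annihilator E = {g. \<forall>x\<in>E. evaluation x g = 0}"

lemma subspace_annihilator: "subspace (annihilator E)"
  by (auto simp: subspace_def annihilator_def evaluation_def blinfun.add_left blinfun.scaleR_left
      blinfun.zero_left)

text \<open>A functional vanishing on the common kernel of finitely many functionals is a linear
  combination of them. Here these are evaluations, so the combination is again an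
  evaluation.\<close>

lemma vanishing_on_annihilator_imp_evaluation:
  fixes \<psi> :: "('v::real_normed_vector \<Rightarrow>\<^sub>L real) \<Rightarrow> real"
  assumes "finite E" "linear \<psi>" "\<And>g. g \<in> annihilator E \<Longrightarrow> \<psi> g = 0"
  shows "\<exists>x. \<psi> = evaluation x"
  using assms
proof (induction E arbitrary: \<psi> rule: finite_induct)
  case empty
  then have "\<psi> = evaluation 0"
    by (auto simp: annihilator_def evaluation_def blinfun.zero_right)
  then show ?case ..
next
  case (insert x E)
  show ?case
  proof (cases "\<exists>g\<in>annihilator E. evaluation x g \<noteq> 0")
    \<comment> \<open>Here adding \<open>x\<close> to \<open>E\<close> leaves the annihilator
      unchanged.\<close>
    case False
    then have "\<psi> g = 0" if "g \<in> annihilator E" for g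
      using insert.prems(2)[of g] that by (auto simp: annihilator_def)
    then show ?thesis using insert.IH insert.prems(1) by blast
  next
    case True
    then obtain g0 where g0: "g0 \<in> annihilator E" "evaluation x g0 \<noteq> 0" by blast
    \<comment> \<open>With this \<open>c\<close> the functional
      \<open>\<psi> - c * evaluation x\<close> vanishes at \<open>g0\<close>; subtracting a multiple
      of \<open>g0\<close> moves any \<open>g\<close> in the annihilator of \<open>E\<close> into
      that of \<open>insert x E\<close>.\<close>
    define c where "c = \<psi> g0 / evaluation x g0"
    let ?\<psi> = "\<lambda>g. \<psi> g - c * evaluation x g"
    note lin = insert.prems(1) linear_evaluation[of x]
    have "linear ?\<psi>"
      by (rule linearI) (simp_all add: linear_add[OF lin(1)] linear_add[OF lin(2)]
          linear_scale[OF lin(1)] linear_scale[OF lin(2)] algebra_simps)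
    moreover have "?\<psi> g = 0" if g: "g \<in> annihilator E" for g
    proof -
      let ?t = "evaluation x g / evaluation x g0"
      have "g - ?t *\<^sub>R g0 \<in> annihilator E"
        using subspace_annihilator g g0(1) by (intro subspace_diff subspace_scale)
      moreover have "evaluation x (g - ?t *\<^sub>R g0) = 0"
        using g0(2) by (simp add: linear_diff[OF lin(2)] linear_scale[OF lin(2)])
      ultimately have "\<psi> (g - ?t *\<^sub>R g0) = 0"
        by (intro insert.prems(2)) (simp add: annihilator_def)
      then show ?thesis
        by (simp add: linear_diff[OF lin(1)] linear_scale[OF lin(1)] c_def mult.commute)
    qed
    ultimately obtain z where z: "?\<psi> = evaluation z" using insert.IH by blast
    have "\<psi> = evaluation (z + c *\<^sub>R x)"
    proof
      show "\<psi> g = evaluation (z + c *\<^sub>R x) g" for g using fun_cong[OF z, of g] by simp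
    qed
    then show ?thesis ..
  qed
qed

text \<open>Otherwise \<open>\<phi>\<close> restricted to the annihilator of \<open>E\<close> has a Hahn--Banach extension of norm at
  most \<open>d\<close>, which differs from \<open>\<phi>\<close> by an evaluation.\<close>

lemma Helly:
  fixes \<phi> :: "('v::real_normed_vector \<Rightarrow>\<^sub>L real) \<Rightarrow> real"
  assumes \<phi>: "linear \<phi>" and d: "0 \<le> d"
    and dist: "\<And>x. \<exists>g. norm g \<le> 1 \<and> d < \<bar>\<phi> g - evaluation x g\<bar>"
    and E: "finite E"
  shows "\<exists>g\<in>annihilator E. norm g \<le> 1 \<and> d < \<phi> g"
proof (rule ccontr)
  assume "\<not> ?thesis"
  then have small: "\<phi> g \<le> d" if "g \<in> annihilator E" "norm g \<le> 1" for g
    using that not_less by blast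
  have "\<phi> g \<le> d * norm g" if g: "g \<in> annihilator E" for g
  proof (cases "g = 0")
    case True
    then show ?thesis by (simp add: linear_0[OF \<phi>])
  next
    case False
    have "\<phi> ((1 / norm g) *\<^sub>R g) \<le> d"
      using False by (intro small subspace_scale[OF subspace_annihilator] g) simp
    then show ?thesis using False by (simp add: linear_scale[OF \<phi>] field_simps)
  qed
  then obtain \<psi> where \<psi>: "linear \<psi>" "\<And>g. \<bar>\<psi> g\<bar> \<le> d * norm g"
    "\<And>g. g \<in> annihilator E \<Longrightarrow> \<psi> g = \<phi> g"
    using Hahn_Banach_extension[OF subspace_annihilator \<phi> d] by blast
  have "linear (\<lambda>g. \<phi> g - \<psi> g)" using \<phi> \<psi>(1) by (rule linear_compose_sub)
  moreover have "\<phi> g - \<psi> g = 0" if "g \<in> annihilator E" for g using \<psi>(3)[OF that] by simp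
  ultimately obtain x where x: "(\<lambda>g. \<phi> g - \<psi> g) = evaluation x"
    using vanishing_on_annihilator_imp_evaluation[OF E] by blast
  obtain g where g: "norm g \<le> 1" "d < \<bar>\<phi> g - evaluation x g\<bar>" using dist by blast
  have "\<phi> g - evaluation x g = \<psi> g" using fun_cong[OF x, of g] by simp
  with g(2) \<psi>(2)[of g] mult_left_mono[OF g(1) d] show False by simp
qed

text \<open>The canonical image of a complete space is closed: points whose evaluations approximate
  \<open>\<phi>\<close> uniformly on the unit ball form a Cauchy sequence by norming functionals,
  and the limit represents \<open>\<phi>\<close>.\<close>

lemma distance_from_range_evaluation:
  fixes \<phi> :: "('v::banach \<Rightarrow>\<^sub>L real) \<Rightarrow> real"
  assumes \<phi>: "linear \<phi>" "\<phi> \<notin> range evaluation"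
  shows "\<exists>d>0. \<forall>x. \<exists>g. norm g \<le> 1 \<and> d < \<bar>\<phi> g - evaluation x g\<bar>"
proof (rule ccontr)
  assume "\<not> ?thesis"
  then have "\<exists>x. \<forall>g. norm g \<le> 1 \<longrightarrow> \<bar>\<phi> g - evaluation x g\<bar> \<le> d" if "0 < d" for d
    using that by (meson not_less)
  then have "\<forall>n. \<exists>x. \<forall>g. norm g \<le> 1 \<longrightarrow> \<bar>\<phi> g - evaluation x g\<bar> \<le> inverse (real (Suc n))"
    by simp
  then obtain x where
    x: "\<And>n g. norm g \<le> 1 \<Longrightarrow> \<bar>\<phi> g - evaluation (x n) g\<bar> \<le> inverse (real (Suc n))"
    using choice[of "\<lambda>n x. \<forall>g. norm g \<le> 1 \<longrightarrow> \<bar>\<phi> g - evaluation x g\<bar> \<le> inverse (real (Suc n))"]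
    by blast
  have diff: "norm (x m - x n) \<le> inverse (real (Suc m)) + inverse (real (Suc n))" for m n
  proof -
    obtain g where g: "norm g \<le> 1" "norm (x m - x n) \<le> blinfun_apply g (x m - x n)"
      by (rule norming_functional)
    have "blinfun_apply g (x m - x n) = evaluation (x m) g - evaluation (x n) g"
      by (simp add: evaluation_def blinfun.diff_right)
    with g(2) x[OF g(1), of m] x[OF g(1), of n] show ?thesis by linarith
  qed
  have "Cauchy x"
  proof (rule metric_CauchyI)
    fix e :: real assume "0 < e"
    then obtain N where N: "inverse (real (Suc N)) < e / 2"
      using reals_Archimedean[of "e / 2"] by auto
    have "dist (x m) (x n) < e" if "N \<le> m" "N \<le> n" for m n
    proof -
      have "inverse (real (Suc m)) \<le> inverse (real (Suc N))"
        "inverse (real (Suc n)) \<le> inverse (real (Suc N))"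
        using that by (simp_all add: le_imp_inverse_le)
      with diff[of m n] N show ?thesis unfolding dist_norm by linarith
    qed
    then show "\<exists>N. \<forall>m\<ge>N. \<forall>n\<ge>N. dist (x m) (x n) < e" by blast
  qed
  then obtain l where l: "x \<longlonglongrightarrow> l" using Cauchy_convergent convergent_def by blast
  have unit: "\<phi> g = evaluation l g" if g: "norm g \<le> 1" for g
  proof -
    have "(\<lambda>n. \<phi> g - evaluation (x n) g) \<longlonglongrightarrow> 0"
      by (rule Lim_null_comparison[OF _ LIMSEQ_inverse_real_of_nat]) (use x[OF g] in simp)
    moreover have "(\<lambda>n. \<phi> g - evaluation (x n) g) \<longlonglongrightarrow> \<phi> g - evaluation l g"
      unfolding evaluation_def by (intro tendsto_intros l)
    ultimately show ?thesis using LIMSEQ_unique by fastforce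
  qed
  have "\<phi> g = evaluation l g" for g
  proof (cases "g = 0")
    case True
    then show ?thesis by (simp add: linear_0[OF \<phi>(1)] linear_0[OF linear_evaluation])
  next
    case False
    have "\<phi> ((1 / norm g) *\<^sub>R g) = evaluation l ((1 / norm g) *\<^sub>R g)"
      using False by (intro unit) simp
    then show ?thesis
      using False by (simp add: linear_scale[OF \<phi>(1)] linear_scale[OF linear_evaluation])
  qed
  then have "\<phi> = evaluation l" by (rule ext)
  with \<phi>(2) show False by blast
qed

section \<open>The pointwise closure of a set of evaluations, and James' sequences\<close>

text \<open>Additivity and homogeneity are closed conditions for pointwise convergence.\<close>

lemma linear_closure_evaluation:
  assumes "\<phi> \<in> closure (evaluation ` A)"
  shows "linear \<phi>"
proof -
  let ?L = "{\<phi> :: ('a \<Rightarrow>\<^sub>L real) \<Rightarrow> real. \<forall>g h. \<phi> (g + h) = \<phi> g + \<phi> h} \<inter>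
    {\<phi>. \<forall>t g. \<phi> (t *\<^sub>R g) = t * \<phi> g}"
  have "closed ?L"
    by (intro closed_Int closed_Collect_all closed_Collect_eq continuous_on_add
        continuous_on_mult_left continuous_on_product_coordinates)
  moreover have "evaluation ` A \<subseteq> ?L"
    using linear_add[OF linear_evaluation] linear_scale[OF linear_evaluation] by auto
  ultimately have "closure (evaluation ` A) \<subseteq> ?L" by (intro closure_minimal)
  with assms have "\<phi> \<in> ?L" by (rule subsetD[rotated])
  then show ?thesis by (intro linearI) simp_all
qed

lemma closure_evaluation_approx:
  assumes "\<phi> \<in> closure (evaluation ` A)" "finite G" "\<And>g. g \<in> G \<Longrightarrow> d < \<phi> g"
  obtains a where "a \<in> A" "\<And>g. g \<in> G \<Longrightarrow> d < evaluation a g"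
proof -
  let ?S = "\<Inter>g\<in>G. {\<psi>. d < \<psi> g}"
  have "open ?S"
    using assms(2)
    by (intro open_INT ballI open_Collect_less continuous_on_const continuous_on_product_coordinates)
  moreover have "\<phi> \<in> ?S \<inter> closure (evaluation ` A)" using assms(1,3) by simp
  ultimately have "?S \<inter> evaluation ` A \<noteq> {}"
    using open_Int_closure_eq_empty[of ?S "evaluation ` A"] by blast
  with that show ?thesis by blast
qed

text \<open>\<open>f n\<close> is chosen by Helly's lemma from the points \<open>x k\<close>, \<open>k < n\<close>, and then
  \<open>x n\<close> approximates \<open>\<phi>\<close> on \<open>f 0, \<dots>, f n\<close>.\<close>

lemma James_sequences:
  fixes A :: "'v::banach set"
  assumes \<phi>: "\<phi> \<in> closure (evaluation ` A)" "\<phi> \<notin> range evaluation"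
  obtains x :: "nat \<Rightarrow> 'v" and d and f :: "nat \<Rightarrow> ('v \<Rightarrow>\<^sub>L real)" where
    "range x \<subseteq> A" "0 < d" "\<forall>n. norm (f n) \<le> 1"
    "\<forall>n. \<forall>k<n. evaluation (x k) (f n) = 0" "\<forall>n. \<forall>k\<ge>n. d < evaluation (x k) (f n)"
proof -
  have lin: "linear \<phi>" using \<phi>(1) by (rule linear_closure_evaluation)
  obtain d where d: "0 < d" "\<And>x. \<exists>g. norm g \<le> 1 \<and> d < \<bar>\<phi> g - evaluation x g\<bar>"
    using distance_from_range_evaluation[OF lin \<phi>(2)] by blast
  have "\<forall>E\<in>Collect finite. \<exists>g. g \<in> annihilator E \<and> norm g \<le> 1 \<and> d < \<phi> g"
    using Helly[OF lin less_imp_le[OF d(1)] d(2)] by blast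
  from bchoice[OF this] obtain F where
    "\<forall>E\<in>Collect finite. F E \<in> annihilator E \<and> norm (F E) \<le> 1 \<and> d < \<phi> (F E)"
    by blast
  then have F: "F E \<in> annihilator E" "norm (F E) \<le> 1" "d < \<phi> (F E)" if "finite E" for E
    using that by simp_all
  have "\<exists>x :: nat \<Rightarrow> 'v. \<forall>n. x n \<in> A \<and> (\<forall>m\<le>n. d < evaluation (x n) (F (x ` {..<m})))"
  proof (rule dependent_wf_choice[OF wf_less])
    fix x y :: "nat \<Rightarrow> 'v" and n r
    assume eq: "\<And>m. (m, n) \<in> {(x, y). x < y} \<Longrightarrow> x m = y m"
    \<comment> \<open>The condition on the value at \<open>n\<close> looks only at earlier values,
      because \<open>m \<le> n\<close>.\<close>
    have "x ` {..<m} = y ` {..<m}" if "m \<le> n" for m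
      using that by (intro image_cong refl eq) simp
    then show "(r \<in> A \<and> (\<forall>m\<le>n. d < evaluation r (F (x ` {..<m})))) =
        (r \<in> A \<and> (\<forall>m\<le>n. d < evaluation r (F (y ` {..<m}))))"
      by simp
  next
    fix n and x :: "nat \<Rightarrow> 'v"
    obtain a where "a \<in> A" "\<And>g. g \<in> (\<lambda>m. F (x ` {..<m})) ` {..n} \<Longrightarrow> d < evaluation a g"
      using closure_evaluation_approx[OF \<phi>(1), of "(\<lambda>m. F (x ` {..<m})) ` {..n}" d] F(3) by blast
    then show "\<exists>r. r \<in> A \<and> (\<forall>m\<le>n. d < evaluation r (F (x ` {..<m})))" by blast
  qed
  then obtain x :: "nat \<Rightarrow> 'v"
    where x: "\<forall>n. x n \<in> A \<and> (\<forall>m\<le>n. d < evaluation (x n) (F (x ` {..<m})))" ..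
  show ?thesis
  proof (rule that[of x d "\<lambda>n. F (x ` {..<n})"])
    show "range x \<subseteq> A" by (rule image_subsetI) (simp add: x)
    show "\<forall>n. norm (F (x ` {..<n})) \<le> 1" using F(2) by simp
    show "\<forall>n. \<forall>k<n. evaluation (x k) (F (x ` {..<n})) = 0"
    proof (intro allI impI)
      fix n k :: nat
      assume "k < n"
      then show "evaluation (x k) (F (x ` {..<n})) = 0"
        using F(1)[of "x ` {..<n}"] by (simp add: annihilator_def)
    qed
    show "\<forall>n. \<forall>k\<ge>n. d < evaluation (x k) (F (x ` {..<n}))" by (simp add: x)
  qed (rule d(1))
qed

section \<open>Convex block subsequences\<close>

text \<open>Passing to finitely many indices turns a combination from a tail into one from a finite
  block, and bounds the indices it uses.\<close>

lemma mem_convex_hull_finite_image: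
  fixes x :: "'i \<Rightarrow> 'v::real_vector"
  assumes "z \<in> convex hull (x ` I)"
  obtains J where "finite J" "J \<subseteq> I" "z \<in> convex hull (x ` J)"
proof -
  obtain S where S: "finite S" "S \<subseteq> x ` I" "z \<in> convex hull S"
    using assms by (auto simp: convex_hull_explicit convex_hull_finite)
  obtain J where "J \<subseteq> I" "finite J" "S = x ` J"
    using finite_subset_image[OF S(1,2)] by blast
  with S(3) that show ?thesis by blast
qed

lemma linear_hull_bound:
  fixes f :: "'v::real_vector \<Rightarrow> real"
  assumes "linear f" "\<And>s. s \<in> S \<Longrightarrow> d \<le> f s" "z \<in> convex hull S"
  shows "d \<le> f z"
proof -
  have "convex (f -` {d..})" using assms(1) by (intro convex_linear_vimage) simp_all
  then have "convex hull S \<subseteq> f -` {d..}" using assms(2) by (intro hull_minimal) auto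
  with assms(3) show ?thesis by auto
qed

context banach_space_over
begin

section \<open>Weak compactness through the product space\<close>

text \<open>A weakly open cover consists of preimages of open sets in the product. These cover
  \<open>K\<close> because every point of \<open>K\<close> is an evaluation, and a finite subcover
  pulls back.\<close>

lemma compactin_weak_topology_vimage:
  assumes K: "compact K" "K \<subseteq> range evaluation"
  shows "compactin (weak_topology smul) (evaluation -` K)"
  unfolding compactin_def
proof (intro conjI allI impI)
  fix \<U> assume "(\<forall>U\<in>\<U>. openin (weak_topology smul) U) \<and> evaluation -` K \<subseteq> \<Union> \<U>"
  then have op: "\<forall>U\<in>\<U>. \<exists>V. open V \<and> evaluation -` V = U" and cov: "evaluation -` K \<subseteq> \<Union> \<U>"
    by (simp_all add: openin_weak_topology_iff)
  from bchoice[OF op] obtain V where V: "\<forall>U\<in>\<U>. open (V U) \<and> evaluation -` V U = U" by blast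
  have "K \<subseteq> (\<Union>U\<in>\<U>. V U)"
  proof
    fix \<phi> assume "\<phi> \<in> K"
    then obtain a where a: "\<phi> = evaluation a" using K(2) by blast
    with \<open>\<phi> \<in> K\<close> cov obtain U where U: "U \<in> \<U>" "a \<in> U" by blast
    with V have "a \<in> evaluation -` V U" by simp
    with U(1) a show "\<phi> \<in> (\<Union>U\<in>\<U>. V U)" by blast
  qed
  then obtain \<F> where \<F>: "\<F> \<subseteq> \<U>" "finite \<F>" "K \<subseteq> (\<Union>U\<in>\<F>. V U)"
    using compactE_image[OF K(1), of \<U> V] V by blast
  have "evaluation -` K \<subseteq> \<Union> \<F>"
  proof
    fix a assume "a \<in> evaluation -` K"
    then obtain U where U: "U \<in> \<F>" "evaluation a \<in> V U" using \<F>(3) by blast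
    then have "a \<in> evaluation -` V U" by simp
    also have "\<dots> = U" using V U(1) \<F>(1) by blast
    finally show "a \<in> \<Union> \<F>" using U(1) by blast
  qed
  with \<F> show "\<exists>\<F>. finite \<F> \<and> \<F> \<subseteq> \<U> \<and> evaluation -` K \<subseteq> \<Union> \<F>" by blast
qed simp

lemma relatively_weakly_compactI:
  assumes "bounded A" and sub: "closure (evaluation ` A) \<subseteq> range evaluation"
  shows "relatively_weakly_compact smul A"
proof -
  obtain M where M: "\<And>a. a \<in> A \<Longrightarrow> norm a \<le> M" using assms(1) by (auto simp: bounded_iff)
  define B :: "(('a \<Rightarrow>\<^sub>L real) \<Rightarrow> real) set" where "B = PiE UNIV (\<lambda>g. cball 0 (norm g * M))"
  have B_eq: "B = {\<phi>. \<forall>g. \<bar>\<phi> g\<bar> \<le> norm g * M}" by (auto simp: B_def PiE_UNIV_domain)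
  have "closed B"
    unfolding B_eq
    by (intro closed_Collect_all closed_Collect_le continuous_on_const continuous_on_rabs
        continuous_on_product_coordinates)
  \<comment> \<open>Tychonoff's theorem\<close>
  have "compactin (product_topology (\<lambda>_. euclidean) UNIV) B"
    unfolding B_def compactin_PiE by simp
  then have B: "compact B" by (simp add: euclidean_product_topology)
  have "evaluation ` A \<subseteq> B"
  proof
    fix \<phi> assume "\<phi> \<in> evaluation ` A"
    then obtain a where a: "a \<in> A" "\<phi> = evaluation a" by blast
    have "\<bar>evaluation a g\<bar> \<le> norm g * M" for g
      using norm_blinfun[of g a] mult_left_mono[OF M[OF a(1)] norm_ge_zero[of g]]
      by (simp add: evaluation_def)
    then show "\<phi> \<in> B" by (simp add: B_eq a(2))
  qed
  define K where "K = closure (evaluation ` A)"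
  have "K \<subseteq> B"
    unfolding K_def using \<open>evaluation ` A \<subseteq> B\<close> \<open>closed B\<close> by (rule closure_minimal)
  then have "B \<inter> K = K" by blast
  then have K: "compact K" using compact_Int_closed[OF B, of K] by (simp add: K_def)
  have "openin (weak_topology smul) (evaluation -` (- K))"
    unfolding openin_weak_topology_iff K_def by (intro exI[of _ "- closure (evaluation ` A)"]) auto
  then have closed: "closedin (weak_topology smul) (evaluation -` K)"
    by (simp add: closedin_def vimage_Compl flip: Compl_eq_Diff_UNIV)
  have "A \<subseteq> evaluation -` K" using closure_subset[of "evaluation ` A"] by (auto simp: K_def)
  then have "weak_topology smul closure_of A \<subseteq> evaluation -` K"
    using closed by (rule closure_of_minimal)
  moreover have "compactin (weak_topology smul) (evaluation -` K)"
    using K sub unfolding K_def by (rule compactin_weak_topology_vimage)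
  ultimately show ?thesis
    unfolding relatively_weakly_compact_def
    using closed_compactin[OF _ _ closedin_closure_of] by blast
qed

lemma James_sequence_no_weak_block_limit:
  fixes x :: "nat \<Rightarrow> 'a" and f :: "nat \<Rightarrow> ('a \<Rightarrow>\<^sub>L real)"
  assumes d: "0 < d" and f: "\<And>n. norm (f n) \<le> 1"
    and zero: "\<And>n k. k < n \<Longrightarrow> evaluation (x k) (f n) = 0"
    and large: "\<And>n k. n \<le> k \<Longrightarrow> d < evaluation (x k) (f n)"
    and y: "convex_block_subsequence y x"
    and l: "limitin (weak_topology smul) y l sequentially"
  shows False
proof -
  obtain k where k: "strict_mono k" "\<And>j. y j \<in> convex hull (x ` {k j..<k (Suc j)})"
    using y unfolding convex_block_subsequence_def by blast
  have lin: "linear (blinfun_apply g)" for g :: "'a \<Rightarrow>\<^sub>L real"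
    by (rule bounded_linear.linear[OF blinfun.bounded_linear_right])
  have "d \<le> blinfun_apply (f n) l" for n
  proof (rule tendsto_lowerbound[OF limitin_weak_topologyD[OF l]])
    show "\<forall>\<^sub>F j in sequentially. d \<le> blinfun_apply (f n) (y j)"
      using eventually_ge_at_top[of n]
    proof eventually_elim
      case (elim j)
      have "d \<le> blinfun_apply (f n) s" if s: "s \<in> x ` {k j..<k (Suc j)}" for s
      proof -
        obtain i where i: "s = x i" "k j \<le> i" using s by auto
        \<comment> \<open>From \<open>n \<le> j \<le> k j \<le> i\<close>: the blocks with index at
          least \<open>n\<close> lie in the range where \<open>f n\<close> exceeds
          \<open>d\<close>.\<close>
        then have "n \<le> i" using elim strict_mono_imp_increasing[OF k(1), of j] by linarith
        with large i(1) show ?thesis by (simp add: evaluation_def less_imp_le)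
      qed
      then show ?case using lin k(2) by (blast intro: linear_hull_bound)
    qed
  qed simp
  note lower = this
  have "range y \<subseteq> convex hull (range x)"
    using k(2) hull_mono[of _ "range x"] by blast
  then have "convex hull (range y) \<subseteq> convex hull (range x)"
    by (intro hull_minimal convex_convex_hull)
  then have "l \<in> closure (convex hull (range x))"
    using weak_limit_in_closure_convex_hull[OF l] closure_mono by blast
  then obtain z where z: "z \<in> convex hull (range x)" "dist z l < d"
    using d by (auto simp: closure_approachable)
  obtain J where J: "finite J" "J \<subseteq> UNIV" "z \<in> convex hull (x ` J)"
    by (rule mem_convex_hull_finite_image[OF z(1)])
  \<comment> \<open>Beyond all indices used by \<open>z\<close>, the functional \<open>f N\<close>
    annihilates \<open>z\<close>; then
    \<open>d \<le> f N (l - z) \<le> norm (l - z) < d\<close>.\<close>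
  obtain N where N: "\<forall>j\<in>J. j < N" using J(1) unfolding finite_nat_set_iff_bounded ..
  have "0 \<le> blinfun_apply (- f N) z"
  proof (rule linear_hull_bound[OF lin _ J(3)])
    fix s assume "s \<in> x ` J"
    then obtain j where j: "s = x j" "j < N" using N by blast
    show "0 \<le> blinfun_apply (- f N) s"
      using zero[OF j(2)] by (simp add: j(1) evaluation_def blinfun.minus_left)
  qed
  then have "d \<le> blinfun_apply (f N) (l - z)"
    using lower[of N] by (simp add: blinfun.minus_left blinfun.diff_right)
  also have "\<dots> \<le> norm (f N) * norm (l - z)"
    using norm_blinfun[of "f N" "l - z"] by simp
  also have "\<dots> \<le> norm (l - z)"
    using mult_right_mono[OF f norm_ge_zero, of N "l - z"] by simp
  also have "\<dots> < d" using z(2) by (simp add: dist_norm norm_minus_commute)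
  finally show False by simp
qed

section \<open>Weak cluster points and the implications between the conditions\<close>

text \<open>The weak closures of the tails have the finite intersection property inside the compact
  closure of \<open>A\<close>: finitely many of them share a late term \<open>x N\<close>.\<close>

lemma weak_cluster_point:
  assumes A: "relatively_weakly_compact smul A" and x: "range x \<subseteq> A"
  obtains l where "\<forall>m::nat. l \<in> weak_topology smul closure_of (x ` {m..})"
proof -
  define C where "C m = weak_topology smul closure_of (x ` {m..})" for m
  define K where "K = weak_topology smul closure_of A"
  have xC: "x n \<in> C m" if "m \<le> n" for m n
    unfolding C_def by (rule subsetD[OF closure_of_subset]) (use that in auto)
  have xK: "x n \<in> K" for n
    unfolding K_def by (rule subsetD[OF closure_of_subset]) (use x in auto)
  have fip: "K \<inter> \<Inter> \<F> \<noteq> {}" if \<F>: "finite \<F>" "\<F> \<subseteq> range C" for \<F>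
  proof -
    obtain I where I: "finite I" "\<F> = C ` I" using finite_subset_image[OF \<F>] by blast
    obtain N where "\<forall>m\<in>I. m < N" using I(1) unfolding finite_nat_set_iff_bounded ..
    then have "x N \<in> K \<inter> \<Inter> \<F>" using xC xK by (simp add: I(2) less_imp_le)
    then show ?thesis by blast
  qed
  have "\<forall>S\<in>range C. closedin (weak_topology smul) S" by (auto simp: C_def)
  moreover have "compactin (weak_topology smul) K"
    using A by (simp add: relatively_weakly_compact_def K_def)
  ultimately have "K \<inter> \<Inter> (range C) \<noteq> {}"
    unfolding compactin_fip using fip by simp
  then obtain l where l: "l \<in> \<Inter> (range C)" by blast
  show ?thesis
  proof (rule that, rule allI)
    show "l \<in> weak_topology smul closure_of (x ` {m..})" for m
      using l by (simp add: C_def)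
  qed
qed

text \<open>A weak cluster point lies in the norm closure of the convex hull of every tail, so
  consecutive finite blocks can be chosen whose combinations approach it in norm.\<close>

lemma relatively_weakly_compact_imp_convergent_blocks:
  assumes A: "relatively_weakly_compact smul A" and x: "range x \<subseteq> A"
  obtains y where "convex_block_subsequence y x" "convergent y"
proof -
  obtain l where l: "\<forall>m::nat. l \<in> weak_topology smul closure_of (x ` {m..})"
    by (rule weak_cluster_point[OF A x])
  have step: "\<exists>m'>m. \<exists>z \<in> convex hull (x ` {m..<m'}). dist z l < e" if e: "0 < e" for m e
  proof -
    have "l \<in> closure (convex hull (x ` {m..}))"
      using l weak_closure_subset_closure_convex_hull by blast
    then obtain z where z: "z \<in> convex hull (x ` {m..})" "dist z l < e"
      using e by (auto simp: closure_approachable)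
    obtain J where J: "finite J" "J \<subseteq> {m..}" "z \<in> convex hull (x ` J)"
      by (rule mem_convex_hull_finite_image[OF z(1)])
    obtain N where N: "\<forall>j\<in>J. j < N" using J(1) unfolding finite_nat_set_iff_bounded ..
    \<comment> \<open>The maximum with \<open>Suc m\<close> makes the block end strictly after
      \<open>m\<close>, which later makes \<open>k\<close> strictly increasing.\<close>
    have "x ` J \<subseteq> x ` {m..<max N (Suc m)}" using J(2) N by (intro image_mono subsetI) (simp add: subset_iff less_max_iff_disj)
    with J(3) have "z \<in> convex hull (x ` {m..<max N (Suc m)})" using hull_mono by blast
    then show ?thesis using z(2) by (intro exI[of _ "max N (Suc m)"]) auto
  qed
  \<comment> \<open>\<open>?P\<close> encodes \<open>k 0 = 0\<close> and is vacuous at later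
    indices; \<open>?Q\<close> relates consecutive block ends.\<close>
  let ?P = "\<lambda>(n::nat) (k::nat). n = 0 \<longrightarrow> k = 0"
  let ?Q = "\<lambda>n k m. k < m \<and> (\<exists>z \<in> convex hull (x ` {k..<m}). dist z l < inverse (real (Suc n)))"
  have "\<exists>k. \<forall>n. ?P n (k n) \<and> ?Q n (k n) (k (Suc n))"
  proof (rule dependent_nat_choice)
    show "\<exists>m. ?P (Suc n) m \<and> ?Q n k m" for k n
      using step[of "inverse (real (Suc n))" k] by simp
  qed simp
  then obtain k where k: "\<forall>n. ?P n (k n) \<and> ?Q n (k n) (k (Suc n))" ..
  then have "\<forall>n. \<exists>z. z \<in> convex hull (x ` {k n..<k (Suc n)}) \<and> dist z l < inverse (real (Suc n))"
    by blast
  from choice[OF this] obtain y where y: "\<forall>n. y n \<in> convex hull (x ` {k n..<k (Suc n)}) \<and>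
      dist (y n) l < inverse (real (Suc n))" ..
  have "(\<lambda>n. dist (y n) l) \<longlonglongrightarrow> 0"
    by (rule Lim_null_comparison[OF _ LIMSEQ_inverse_real_of_nat])
      (use y in \<open>simp add: less_imp_le\<close>)
  then have "y \<longlonglongrightarrow> l" by (rule iffD2[OF tendsto_dist_iff])
  moreover have "convex_block_subsequence y x"
    unfolding convex_block_subsequence_def
    using k y by (intro exI[of _ k]) (simp add: strict_mono_Suc_iff)
  ultimately show ?thesis by (intro that convergentI)
qed

text \<open>If the pointwise closure contained a point that is not an evaluation, it would produce a
  James sequence in \<open>A\<close>, contradicting the block condition.\<close>

lemma weakly_convergent_blocks_imp_relatively_weakly_compact:
  assumes "bounded A"
    and blocks: "\<And>x :: nat \<Rightarrow> 'a. range x \<subseteq> A \<Longrightarrow>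
      \<exists>y. convex_block_subsequence y x \<and> weakly_convergent smul y"
  shows "relatively_weakly_compact smul A"
proof (rule relatively_weakly_compactI[OF assms(1)], rule subsetI, rule ccontr)
  fix \<phi> assume "\<phi> \<in> closure (evaluation ` A)" "\<phi> \<notin> range evaluation"
  then obtain x :: "nat \<Rightarrow> 'a" and d and f :: "nat \<Rightarrow> ('a \<Rightarrow>\<^sub>L real)"
    where x: "range x \<subseteq> A" and James: "0 < d" "\<forall>n. norm (f n) \<le> 1"
    "\<forall>n. \<forall>k<n. evaluation (x k) (f n) = 0" "\<forall>n. \<forall>k\<ge>n. d < evaluation (x k) (f n)"
    by (rule James_sequences)
  from blocks[OF x] obtain y l where y: "convex_block_subsequence y x"
    "limitin (weak_topology smul) y l sequentially"
    unfolding weakly_convergent_def by blast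
  show False
    by (rule James_sequence_no_weak_block_limit[where f = f, OF James(1) _ _ _ y]) (use James(2-4) in simp_all)
qed

end

theorem lemma4p1:
  fixes smul :: "'k::real_or_complex_field \<Rightarrow> 'a::banach \<Rightarrow> 'a"
    and A :: "'a set"
  assumes "banach_space_over smul"
    and "infinite_dimensional smul"
    and "bounded A"
  shows "(relatively_weakly_compact smul A \<longleftrightarrow>
            (\<forall>x :: nat \<Rightarrow> 'a. range x \<subseteq> A \<longrightarrow>
               (\<exists>y. convex_block_subsequence y x \<and> convergent y))) \<and>
         (relatively_weakly_compact smul A \<longleftrightarrow>
            (\<forall>x :: nat \<Rightarrow> 'a. range x \<subseteq> A \<longrightarrow>
               (\<exists>y. convex_block_subsequence y x \<and> weakly_convergent smul y)))"
    (is "(?one \<longleftrightarrow> ?two) \<and> (?one \<longleftrightarrow> ?three)")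
proof -
  interpret banach_space_over smul by (rule assms(1))
  \<comment> \<open>The equivalences follow from the cycle \<open>?one\<close>, \<open>?two\<close>,
    \<open>?three\<close>, \<open>?one\<close>.\<close>
  have two: ?two if ?one
  proof (intro allI impI)
    fix x :: "nat \<Rightarrow> 'a"
    assume "range x \<subseteq> A"
    with that obtain y where "convex_block_subsequence y x" "convergent y"
      by (rule relatively_weakly_compact_imp_convergent_blocks)
    then show "\<exists>y. convex_block_subsequence y x \<and> convergent y" by blast
  qed
  have "weakly_convergent smul y" if "convergent y" for y
    using that limitin_weak_topologyI unfolding weakly_convergent_def convergent_def by blast
  then have three: ?three if ?two
    using that by blast
  have ?one if ?three
    using assms(3) that by (intro weakly_convergent_blocks_imp_relatively_weakly_compact) simp_all
  with two three show ?thesis by argo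
qed

end
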